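(* Let $\|\cdot\|$ be a norm on $\mathbb{R}^2$ and let $v_1,\dots,v_n\in\mathbb{R}^2$ be a sequence of vectors with $\|v_i\|=1$ for all $i$. Then there are signs $\varepsilon_i\in\{-1,+1\}$ $(i=1,\dots,n)$ such that $\left\|\sum_{i=1}^k\varepsilon_iv_i\right\|\le 2$ for every odd $k\in\{1,\dots,n\}$. *)

theory Defs
  imports "HOL-Analysis.Analysis"
begin

(* The type class norm on real^2 is the Euclidean one, so an arbitrary norm is
   represented as a function satisfying the norm axioms. *)
definition is_norm :: "('a::real_vector \<Rightarrow> real) \<Rightarrow> bool" where
  "is_norm N \<longleftrightarrow>
     (\<forall>x. 0 \<le> N x) \<and>
     (\<forall>x. N x = 0 \<longleftrightarrow> x = 0) \<and>
     (\<forall>c x. N (c *\<^sub>R x) = \<bar>c\<bar> * N x) \<and>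
     (\<forall>x y. N (x + y) \<le> N x + N y)"

end

(* Process the vectors in pairs. The point is that a vector x with N x \<le> 2 can be
   kept in the ball of radius 2 when a pair of unit vectors u, w is added with suitable
   signs. If u, w are parallel, let them cancel. Otherwise write x = a u + b w;
   replacing u, w by their negatives if necessary, a, b \<ge> 0, and then x - u - w works:
   for a + b \<le> 2 this is the triangle inequality, and for a + b \<ge> 2 one writes
   x - u - w as a combination of x, u and w whose u- and w-coefficients are opposite. *)
theory Submission
  imports Defs
begin

lemma is_norm_scale: "is_norm N \<Longrightarrow> N (c *\<^sub>R x) = \<bar>c\<bar> * N x"
  by (simp add: is_norm_def)

lemma is_norm_triangle: "is_norm N \<Longrightarrow> N (x + y) \<le> N x + N y"
  by (simp add: is_norm_def)

lemma is_norm_combination_le: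
  assumes "is_norm N" "N u = 1" "N w = 1"
  shows "N (a *\<^sub>R u + b *\<^sub>R w) \<le> \<bar>a\<bar> + \<bar>b\<bar>"
  using is_norm_triangle[OF assms(1), of "a *\<^sub>R u" "b *\<^sub>R w"]
  by (simp add: is_norm_scale assms)

text \<open>The reverse triangle inequality: subtracting \<open>b *\<^sub>R w\<close> isolates the
  \<open>u\<close>-term. With nonnegative coefficients, using it for both orders of \<open>u\<close>
  and \<open>w\<close> bounds their difference by the norm of the combination.\<close>

lemma is_norm_coeff_le:
  assumes "is_norm N" "N u = 1" "N w = 1"
  shows "\<bar>a\<bar> \<le> N (a *\<^sub>R u + b *\<^sub>R w) + \<bar>b\<bar>"
  using is_norm_triangle[OF assms(1), of "a *\<^sub>R u + b *\<^sub>R w" "(- b) *\<^sub>R w"]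
    is_norm_scale[OF assms(1), of a u] is_norm_scale[OF assms(1), of "- b" w]
  by (simp add: assms)

lemma nonneg_combination_minus_le_2:
  assumes N: "is_norm N" and u: "N u = 1" and w: "N w = 1"
    and x: "x = a *\<^sub>R u + b *\<^sub>R w" "N x \<le> 2" and ab: "0 \<le> a" "0 \<le> b"
  shows "N (x - u - w) \<le> 2"
proof (cases "a + b \<le> 2")
  case True
  have "x - u - w = (a - 1) *\<^sub>R u + (b - 1) *\<^sub>R w"
    by (simp add: x(1) algebra_simps)
  then have "N (x - u - w) \<le> \<bar>a - 1\<bar> + \<bar>b - 1\<bar>"
    using is_norm_combination_le[OF N u w] by simp
  then show ?thesis using ab True by linarith
next
  case False
  \<comment> \<open>Removing \<open>(1 - t) *\<^sub>R x\<close> from \<open>x - u - w\<close> leaves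
    the coefficients \<open>t * a - 1\<close> and \<open>t * b - 1\<close>; this \<open>t\<close>
    makes their sum zero. As \<open>a + b > 2\<close>, the weight \<open>1 - t\<close> is
    nonnegative.\<close>
  define t where "t = 2 / (a + b)"
  have t: "0 \<le> t" "t \<le> 1" "t * (a + b) = 2"
    using False by (simp_all add: t_def del: distrib_left_numeral)
  have diff: "\<bar>a - b\<bar> \<le> 2"
    using is_norm_coeff_le[OF N u w, of a b] is_norm_coeff_le[OF N w u, of b a] x ab
    by (simp add: add.commute)
  have e: "t * b - 1 = - (t * a - 1)"
    using t(3) by (simp add: algebra_simps)
  have "x - u - w = (1 - t) *\<^sub>R x + ((t * a - 1) *\<^sub>R u + (t * b - 1) *\<^sub>R w)"
    by (simp add: x(1) algebra_simps)
  then have "N (x - u - w) \<le> N ((1 - t) *\<^sub>R x) + N ((t * a - 1) *\<^sub>R u + (t * b - 1) *\<^sub>R w)"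
    using is_norm_triangle[OF N] by simp
  also have "\<dots> \<le> (1 - t) * N x + (\<bar>t * a - 1\<bar> + \<bar>t * b - 1\<bar>)"
    using is_norm_combination_le[OF N u w, of "t * a - 1" "t * b - 1"] t
    by (simp add: is_norm_scale[OF N])
  \<comment> \<open>For opposite numbers the absolute values add up to that of their difference.
    Since \<open>\<bar>a - b\<bar> \<le> 2\<close>, this part costs at most \<open>2 * t\<close>,
    and the total is \<open>(1 - t) * 2 + t * 2 = 2\<close>.\<close>
  also have "\<bar>t * a - 1\<bar> + \<bar>t * b - 1\<bar> = \<bar>t * (a - b)\<bar>"
    using e unfolding right_diff_distrib by linarith
  also have "\<dots> \<le> t * 2"
    unfolding abs_mult using t diff by (simp add: mult_left_mono)
  also have "(1 - t) * N x \<le> (1 - t) * 2"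
    using t x(2) by (intro mult_left_mono) auto
  finally show ?thesis by simp
qed

lemma combination_add_signed_le_2:
  assumes N: "is_norm N" and u: "N u = 1" and w: "N w = 1"
    and x: "x = a *\<^sub>R u + b *\<^sub>R w" "N x \<le> 2"
  shows "\<exists>s\<in>{-1, 1}. \<exists>t\<in>{-1, 1}. N (x + s *\<^sub>R u + t *\<^sub>R w) \<le> 2"
proof -
  \<comment> \<open>With the signs of \<open>a\<close> and \<open>b\<close>, the vector
    \<open>x\<close> has coefficients \<open>\<bar>a\<bar>\<close> and \<open>\<bar>b\<bar>\<close>
    over the unit vectors \<open>s *\<^sub>R u\<close> and \<open>t *\<^sub>R w\<close>. These get
    subtracted, so the witnesses are \<open>- s\<close> and \<open>- t\<close>.\<close>
  define s t :: real where "s = (if a \<ge> 0 then 1 else -1)" and "t = (if b \<ge> 0 then 1 else -1)"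
  have "N (x - s *\<^sub>R u - t *\<^sub>R w) \<le> 2"
    by (rule nonneg_combination_minus_le_2[where a = "\<bar>a\<bar>" and b = "\<bar>b\<bar>"])
       (use N u w x in \<open>auto simp: s_def t_def is_norm_scale\<close>)
  then have "N (x + (- s) *\<^sub>R u + (- t) *\<^sub>R w) \<le> 2" by simp
  moreover have "- s \<in> {-1, 1}" "- t \<in> {-1, 1}" by (auto simp: s_def t_def)
  ultimately show ?thesis by blast
qed

lemma parallel_or_spanning_2:
  fixes u w x :: "real ^ 2"
  assumes "u \<noteq> 0"
  obtains c where "w = c *\<^sub>R u" | a b where "x = a *\<^sub>R u + b *\<^sub>R w"
proof (cases "\<exists>c. w = c *\<^sub>R u")
  case False
  then have "w \<notin> span {u}" by (auto simp: span_singleton)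
  then have "independent {w, u}" "w \<noteq> u"
    using assms by (auto simp: independent_insert span_base)
  \<comment> \<open>Two independent vectors in a space of dimension 2 span it.\<close>
  then have "span {w, u} = UNIV"
    using card_ge_dim_independent[of "{w, u}" UNIV] by (auto simp: dim_UNIV)
  then obtain k where "x - k *\<^sub>R w \<in> span {u}"
    using span_breakdown_eq[of x w "{u}"] by auto
  then obtain l where "x - k *\<^sub>R w = l *\<^sub>R u"
    by (auto simp: span_singleton)
  then have "x = l *\<^sub>R u + k *\<^sub>R w" by (simp add: algebra_simps)
  then show ?thesis by (rule that(2))
qed (use that in blast)

lemma add_signed_pair_le_2:
  fixes N :: "real ^ 2 \<Rightarrow> real"
  assumes N: "is_norm N" and u: "N u = 1" and w: "N w = 1" and x: "N x \<le> 2"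
  shows "\<exists>s\<in>{-1, 1}. \<exists>t\<in>{-1, 1}. N (x + s *\<^sub>R u + t *\<^sub>R w) \<le> 2"
proof -
  have "u \<noteq> 0" using is_norm_scale[OF N, of 0 u] u by auto
  then consider c where "w = c *\<^sub>R u" | a b where "x = a *\<^sub>R u + b *\<^sub>R w"
    by (rule parallel_or_spanning_2)
  then show ?thesis
  proof cases
    case 1
    then have "\<bar>c\<bar> = 1" using w u by (simp add: is_norm_scale[OF N])
    then have "c = 1 \<or> c = - 1" by linarith
    \<comment> \<open>Here \<open>w\<close> is \<open>u\<close> or \<open>- u\<close>, so suitable
      signs make the pair cancel and leave \<open>x\<close>.\<close>
    then show ?thesis using 1 x by auto
  next
    case 2
    then show ?thesis using combination_add_signed_le_2[OF N u w] x by blast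
  qed
qed

text \<open>Induction on \<open>m\<close>: the first partial sum is a unit vector, and each step
  adds one pair by \<open>add_signed_pair_le_2\<close>. Signs are required at every index, so that
  those beyond \<open>2 * m + 1\<close> are valid too.\<close>

lemma signs_up_to_odd:
  fixes N :: "real ^ 2 \<Rightarrow> real"
  assumes N: "is_norm N" and v: "\<And>i. i \<in> {1..2 * m + 1} \<Longrightarrow> N (v i) = 1"
  shows "\<exists>\<epsilon> :: nat \<Rightarrow> real. (\<forall>i. \<epsilon> i \<in> {-1, 1}) \<and>
           (\<forall>j\<le>m. N (\<Sum>i=1..2 * j + 1. \<epsilon> i *\<^sub>R v i) \<le> 2)"
  using v
proof (induction m)
  case 0
  then show ?case by (intro exI[of _ "\<lambda>_. 1"]) simp
next
  case (Suc m)
  have "N (v i) = 1" if "i \<in> {1..2 * m + 1}" for i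
    using that by (intro Suc.prems) simp
  from Suc.IH[OF this] obtain \<epsilon> :: "nat \<Rightarrow> real" where \<epsilon>: "\<And>i. \<epsilon> i \<in> {-1, 1}"
    "\<And>j. j \<le> m \<Longrightarrow> N (\<Sum>i=1..2 * j + 1. \<epsilon> i *\<^sub>R v i) \<le> 2"
    by blast
  let ?p = "2 * m + 2" and ?q = "2 * m + 3"
  have "N (v ?p) = 1" "N (v ?q) = 1" using Suc.prems by simp_all
  then obtain s t :: real where st: "s \<in> {-1, 1}" "t \<in> {-1, 1}"
    "N ((\<Sum>i=1..2 * m + 1. \<epsilon> i *\<^sub>R v i) + s *\<^sub>R v ?p + t *\<^sub>R v ?q) \<le> 2"
    using add_signed_pair_le_2[OF N _ _ \<epsilon>(2)[OF order_refl]] by blast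
  \<comment> \<open>Only the two new indices change, so all earlier partial sums keep their
    bounds.\<close>
  define \<delta> where "\<delta> = \<epsilon>(?p := s, ?q := t)"
  have old: "(\<Sum>i=1..2 * j + 1. \<delta> i *\<^sub>R v i) = (\<Sum>i=1..2 * j + 1. \<epsilon> i *\<^sub>R v i)" if "j \<le> m" for j
    using that by (intro sum.cong) (auto simp: \<delta>_def)
  have "{1..2 * Suc m + 1} = insert ?q (insert ?p {1..2 * m + 1})" by auto
  then have "(\<Sum>i=1..2 * Suc m + 1. \<delta> i *\<^sub>R v i)
      = (\<Sum>i=1..2 * m + 1. \<delta> i *\<^sub>R v i) + s *\<^sub>R v ?p + t *\<^sub>R v ?q"
    by (simp add: \<delta>_def)
  then have "N (\<Sum>i=1..2 * Suc m + 1. \<delta> i *\<^sub>R v i) \<le> 2"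
    using st(3) by (simp only: old[OF order_refl])
  then have "\<forall>j\<le>Suc m. N (\<Sum>i=1..2 * j + 1. \<delta> i *\<^sub>R v i) \<le> 2"
    using \<epsilon>(2) old by (metis le_Suc_eq)
  moreover have "\<forall>i. \<delta> i \<in> {-1, 1}" using \<epsilon>(1) st by (auto simp: \<delta>_def)
  ultimately show ?case by blast
qed

theorem theorem4:
  fixes N :: "real ^ 2 \<Rightarrow> real" and v :: "nat \<Rightarrow> real ^ 2" and n :: nat
  assumes "is_norm N"
    and "\<And>i. i \<in> {1..n} \<Longrightarrow> N (v i) = 1"
  shows "\<exists>\<epsilon> :: nat \<Rightarrow> real. (\<forall>i\<in>{1..n}. \<epsilon> i \<in> {-1, 1}) \<and>
           (\<forall>k\<in>{1..n}. odd k \<longrightarrow> N (\<Sum>i=1..k. \<epsilon> i *\<^sub>R v i) \<le> 2)"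
proof (cases "n = 0")
  case False
  \<comment> \<open>The odd \<open>k \<le> n\<close> are exactly the \<open>2 * j + 1\<close> with
    \<open>j \<le> m\<close>. For even \<open>n\<close> the last vector enters no odd partial sum,
    and its sign is arbitrary.\<close>
  define m where "m = (n - 1) div 2"
  have "2 * m + 1 \<le> n" using False by (simp add: m_def)
  then have "N (v i) = 1" if "i \<in> {1..2 * m + 1}" for i
    using that by (intro assms(2)) simp
  from signs_up_to_odd[OF assms(1), of m v, OF this] obtain \<epsilon> :: "nat \<Rightarrow> real"
    where \<epsilon>: "\<And>i. \<epsilon> i \<in> {-1, 1}"
      "\<And>j. j \<le> m \<Longrightarrow> N (\<Sum>i=1..2 * j + 1. \<epsilon> i *\<^sub>R v i) \<le> 2"
    by blast
  have "N (\<Sum>i=1..k. \<epsilon> i *\<^sub>R v i) \<le> 2" if "k \<in> {1..n}" "odd k" for k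
  proof -
    obtain j where "k = 2 * j + 1" using \<open>odd k\<close> by (elim oddE)
    moreover from this have "j \<le> m" using that by (simp add: m_def)
    ultimately show ?thesis using \<epsilon>(2) by simp
  qed
  then show ?thesis using \<epsilon>(1) by blast
qed simp

end
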